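(* Let $X$ be a metrizable space, let $Y$ be a regular space, and let $f \colon X \to Y$ be a resolvable-measurable mapping. Then $f$ is piecewise continuous.
   Context: Mappings are not assumed continuous. Regular spaces are understood in the sense of Engelking's "General Topology" (in particular, they are $T_1$). A subset $E$ of a space $X$ is resolvable if it can be represented as $E = (F_1 \setminus F_2) \cup (F_3 \setminus F_4) \cup \ldots \cup (F_\xi \setminus F_{\xi+1}) \cup \ldots$, where $\langle F_\xi \rangle$ is a decreasing transfinite sequence of closed sets in $X$. Equivalently (indexing from $0$), there are an ordinal $\kappa$ and a decreasing sequence $\langle F_\xi \colon \xi < \kappa\rangle$ of closed sets such that $E$ is the union of $F_\xi \setminus F_{\xi+1}$ over all even ordinals $\xi$ with $\xi+1<\kappa$ (an ordinal is even if it has the form $\lambda + 2n$ with $\lambda$ zero or a limit ordinal and $n<\omega$). A mapping $f \colon X \to Y$ is resolvable-measurable if $f^{-1}(U)$ is a resolvable subset of $X$ for every open set $U \subset Y$. A mapping $f \colon X \to Y$ is piecewise continuous if $X$ can be covered by a sequence $X_0, X_1, \ldots$ of closed sets such that the restriction $f \upharpoonright X_n$ is continuous for every $n \in \omega$. *)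

theory Defs
  imports "HOL-Analysis.Analysis"
begin

text \<open>
  An ordinal \<open>\<kappa>\<close> is represented by a well-order \<open>r\<close>, whose field plays the role of the set of all
  ordinals \<open>\<xi> < \<kappa>\<close>. A pair \<open>(i, j)\<close> is in \<open>next_rel r\<close> iff \<open>j = i + 1\<close>: the elements strictly
  below \<open>j\<close> are exactly those below or equal to \<open>i\<close>. If \<open>\<kappa>\<close> is a successor ordinal, the last
  element of \<open>r\<close> has no successor in \<open>next_rel r\<close>.
\<close>

definition next_rel :: "'i rel \<Rightarrow> 'i rel" where
  "next_rel r = {(i, j). i \<in> Field r \<and> j \<in> Field r \<and> underS r j = under r i}"

text \<open>
  Even ordinals are those of the form \<open>\<lambda> + 2n\<close>; here \<open>l\<close> is zero or a limit iff it is not a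
  successor.
\<close>

definition even_index :: "'i rel \<Rightarrow> 'i \<Rightarrow> bool" where
  "even_index r i \<longleftrightarrow>
     (\<exists>l n. l \<in> Field r \<and> (\<nexists>k. (k, l) \<in> next_rel r) \<and> (l, i) \<in> next_rel r ^^ (2 * n))"

text \<open>
  HOL cannot quantify over types inside a formula, so the type \<open>'i\<close> carrying the ordinals is a
  parameter: \<open>resolvable TYPE('i) X E\<close> says that \<open>E\<close> is represented by a transfinite sequence
  indexed by an ordinal that embeds into \<open>'i\<close>. When \<open>resolvable TYPE('i)\<close> (or a notion built
  on it) occurs as a hypothesis with \<open>'i\<close> a free type variable, ordinals of any size are covered.
\<close>

definition resolvable :: "'i itself \<Rightarrow> 'a topology \<Rightarrow> 'a set \<Rightarrow> bool" where
  "resolvable (index_type :: 'i itself) X E \<longleftrightarrow>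
     (\<exists>(r :: 'i rel) (F :: 'i \<Rightarrow> 'a set).
        Well_order r \<and>
        (\<forall>i \<in> Field r. closedin X (F i)) \<and>
        (\<forall>i j. (i, j) \<in> r \<longrightarrow> F j \<subseteq> F i) \<and>
        E = \<Union> {F i - F j | i j. even_index r i \<and> (i, j) \<in> next_rel r})"

definition resolvable_measurable ::
    "'i itself \<Rightarrow> 'a topology \<Rightarrow> 'b topology \<Rightarrow> ('a \<Rightarrow> 'b) \<Rightarrow> bool" where
  "resolvable_measurable (index_type :: 'i itself) X Y f \<longleftrightarrow>
     (\<forall>U. openin Y U \<longrightarrow> resolvable TYPE('i) X {x \<in> topspace X. f x \<in> U})"

definition piecewise_continuous :: "'a topology \<Rightarrow> 'b topology \<Rightarrow> ('a \<Rightarrow> 'b) \<Rightarrow> bool" where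
  "piecewise_continuous X Y f \<longleftrightarrow>
     (\<exists>C :: nat \<Rightarrow> 'a set.
        (\<forall>n. closedin X (C n)) \<and>
        (\<Union>n. C n) = topspace X \<and>
        (\<forall>n. continuous_map (subtopology X (C n)) Y f))"

end

theory Submission
  imports Defs "HOL-Library.Nat_Bijection"
begin

text \<open>
  If \<open>E\<close> is resolvable, every nonempty set \<open>A\<close> has a nonempty relatively open part contained in \<open>E\<close>
  or disjoint from it. Call \<open>B\<close> tame if each nonempty \<open>A \<subseteq> B\<close> meets an open \<open>V\<close> such that \<open>f\<close> is
  continuous on the closure of \<open>V \<inter> A\<close>; the tame sets form an ideal. If the whole space were not
  tame, one could choose points \<open>x\<^sub>n\<close>, forming a set without isolated points, and open sets
  \<open>W\<^sub>n \<ni> f x\<^sub>n\<close> with disjoint closures. Then every subset of \<open>{x\<^sub>0, x\<^sub>1, \<dots>}\<close> is the trace of the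
  preimage of a union of some of the \<open>W\<^sub>n\<close>; taking one that is dense and codense gives a preimage
  that is not resolvable. So the space is tame, which yields an increasing transfinite sequence of
  open sets \<open>G\<^sub>\<xi>\<close> exhausting it with \<open>f\<close> continuous on each \<open>G\<^sub>\<xi>\<^sub>+\<^sub>1 - G\<^sub>\<xi>\<close>. The points of these
  differences at distance at least \<open>1 / n\<close> from the complement of \<open>G\<^sub>\<xi>\<^sub>+\<^sub>1\<close> form, over all \<open>\<xi>\<close>, a
  uniformly discrete family of closed sets, and its union is the \<open>n\<close>-th piece.
\<close>

section \<open>Resolvable sets and topological preliminaries\<close>

text \<open>Let \<open>i\<close> be the least index with \<open>A\<close> not inside
  \<open>F i\<close>. The part of \<open>A\<close> off \<open>F i\<close> is relatively open and
  lies in \<open>F j\<close> for every \<open>j\<close> below \<open>i\<close>, so it is inside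
  \<open>E\<close> or disjoint from \<open>E\<close> according to whether \<open>i\<close> succeeds
  an even index.\<close>

lemma resolvable_locally_decided:
  assumes "resolvable TYPE('i) X E" "A \<subseteq> topspace X" "A \<noteq> {}"
  shows "\<exists>V. openin X V \<and> V \<inter> A \<noteq> {} \<and> (V \<inter> A \<subseteq> E \<or> V \<inter> A \<inter> E = {})"
proof -
  obtain r :: "'i rel" and F where wo: "Well_order r"
    and cl: "\<And>i. i \<in> Field r \<Longrightarrow> closedin X (F i)"
    and dec: "\<And>i j. (i, j) \<in> r \<Longrightarrow> F j \<subseteq> F i"
    and E: "E = \<Union> {F i - F j | i j. even_index r i \<and> (i, j) \<in> next_rel r}"
    using assms(1) unfolding resolvable_def by blast
  show ?thesis
  proof (cases "\<forall>i \<in> Field r. A \<subseteq> F i")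
    case True
    then have "A \<inter> E = {}"
      unfolding E next_rel_def by blast
    then show ?thesis
      using assms by (intro exI[of _ "topspace X"]) auto
  next
    case False
    have wf: "wf (r - Id)" and tot: "Total r" and refl: "Refl r"
      using wo by (auto simp: well_order_on_def linear_order_on_def partial_order_on_def
          preorder_on_def)
    define I where "I = {i \<in> Field r. \<not> A \<subseteq> F i}"
    obtain i0 where "i0 \<in> I"
      using False by (auto simp: I_def)
    from wf[unfolded wf_eq_minimal, rule_format, OF this]
    obtain i where i: "i \<in> Field r" "\<not> A \<subseteq> F i"
      and least: "\<And>j. (j, i) \<in> r - Id \<Longrightarrow> j \<in> Field r \<Longrightarrow> A \<subseteq> F j"
      by (auto simp: I_def)
    define V where "V = topspace X - F i"
    have V: "openin X V" "V \<inter> A \<noteq> {}"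
      using cl[OF i(1)] i(2) assms(2) by (auto simp: V_def)
    have below: "A \<subseteq> F j" if "j \<in> underS r i" for j
      using that least by (auto simp: underS_def Field_def)
    have "V \<inter> A \<subseteq> E \<or> V \<inter> A \<inter> E = {}"
    proof (cases "\<exists>j. even_index r j \<and> (j, i) \<in> next_rel r")
      case True
      then obtain j where j: "even_index r j" "(j, i) \<in> next_rel r"
        by blast
      then have "j \<in> underS r i"
        using refl by (auto simp: next_rel_def under_def refl_on_def)
      then have "A \<subseteq> F j"
        by (rule below)
      then show ?thesis
        using j by (auto simp: E V_def)
    next
      case False
      \<comment> \<open>If \<open>x\<close> is in \<open>F k - F l\<close>, then \<open>i\<close> is
        not at or below \<open>k\<close>, because \<open>x\<close> is off \<open>F i\<close>, and
        \<open>l\<close> is not below \<open>i\<close>, because \<open>x\<close> is in all earlier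
        sets. This forces \<open>l = i\<close>.\<close>
      have "x \<notin> E" if x: "x \<in> V" "x \<in> A" for x
      proof
        assume "x \<in> E"
        then obtain k l where kl: "even_index r k" "(k, l) \<in> next_rel r" "x \<in> F k" "x \<notin> F l"
          by (auto simp: E)
        have fld: "k \<in> Field r" "l \<in> Field r" and eq: "underS r l = under r k"
          using kl(2) by (auto simp: next_rel_def)
        have ik: "(i, k) \<notin> r"
          using dec[of i k] x kl(3) by (auto simp: V_def)
        have "l \<notin> underS r i"
          using below x kl(4) by blast
        moreover have "i \<notin> underS r l"
          using ik by (auto simp: eq under_def)
        ultimately have "l = i"
          using tot fld i(1) by (auto simp: underS_def total_on_def)
        then show False
          using False kl by blast
      qed
      then show ?thesis
        by blast
    qed
    then show ?thesis
      using V by blast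
  qed
qed

lemma regular_space_shrink:
  assumes "regular_space X" "openin X W" "x \<in> W"
  obtains U where "openin X U" "x \<in> U" "X closure_of U \<subseteq> W"
proof -
  obtain U V where "openin X U" "closedin X V" "x \<in> U" "U \<subseteq> V" "V \<subseteq> W"
    using assms unfolding neighbourhood_base_of_closedin[symmetric] neighbourhood_base_of
    by metis
  then show ?thesis
    using that closure_of_minimal by (metis order_trans)
qed

lemma continuous_map_subtopology_iff:
  assumes "f \<in> topspace X \<rightarrow> topspace Y" "S \<subseteq> topspace X"
  shows "continuous_map (subtopology X S) Y f \<longleftrightarrow>
    (\<forall>x\<in>S. \<forall>W. openin Y W \<and> f x \<in> W \<longrightarrow> (\<exists>V. openin X V \<and> x \<in> V \<and> f ` (V \<inter> S) \<subseteq> W))"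
    (is "?L \<longleftrightarrow> ?R")
proof
  assume L: ?L
  show ?R
  proof (intro ballI allI impI)
    fix x W assume x: "x \<in> S" "openin Y W \<and> f x \<in> W"
    have "openin (subtopology X S) {z \<in> topspace (subtopology X S). f z \<in> W}"
      using L x by (blast intro: openin_continuous_map_preimage)
    then obtain V where V: "openin X V" "{z \<in> topspace (subtopology X S). f z \<in> W} = V \<inter> S"
      unfolding openin_subtopology by blast
    have "x \<in> V" "f ` (V \<inter> S) \<subseteq> W"
      using V(2) x assms(2) by auto
    with V(1) show "\<exists>V. openin X V \<and> x \<in> V \<and> f ` (V \<inter> S) \<subseteq> W"
      by blast
  qed
next
  assume R: ?R
  have "openin (subtopology X S) {z \<in> S. f z \<in> W}" if W: "openin Y W" for W
  proof (subst openin_subopen, intro ballI)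
    fix x assume "x \<in> {z \<in> S. f z \<in> W}"
    then obtain V where "openin X V" "x \<in> V" "f ` (V \<inter> S) \<subseteq> W" "x \<in> S"
      using R W by blast
    then show "\<exists>T. openin (subtopology X S) T \<and> x \<in> T \<and> T \<subseteq> {z \<in> S. f z \<in> W}"
      by (intro exI[of _ "V \<inter> S"]) (auto simp: openin_subtopology)
  qed
  moreover have "topspace (subtopology X S) = S"
    using assms(2) by auto
  ultimately show ?L
    using assms by (auto simp: continuous_map_def)
qed

section \<open>Tame sets\<close>

text \<open>Continuity is required on the closure so that a good \<open>V\<close> for a dense subset
  of \<open>A\<close> is also good for \<open>A\<close>; \<open>tame_Un\<close> rests on
  this.\<close>

definition tame :: "'a topology \<Rightarrow> 'b topology \<Rightarrow> ('a \<Rightarrow> 'b) \<Rightarrow> 'a set \<Rightarrow> bool" where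
  "tame X Y f B \<longleftrightarrow> (\<forall>A \<subseteq> B. A \<noteq> {} \<longrightarrow>
     (\<exists>V. openin X V \<and> V \<inter> A \<noteq> {} \<and>
       continuous_map (subtopology X (X closure_of (V \<inter> A))) Y f))"

lemma tame_subset:
  assumes "tame X Y f B" "A \<subseteq> B"
  shows "tame X Y f A"
  unfolding tame_def
proof (intro allI impI)
  fix C assume "C \<subseteq> A" "C \<noteq> {}"
  then show "\<exists>V. openin X V \<and> V \<inter> C \<noteq> {} \<and>
       continuous_map (subtopology X (X closure_of (V \<inter> C))) Y f"
    using assms(2) by (intro assms(1)[unfolded tame_def, rule_format]) auto
qed

text \<open>Either some nonempty relatively open part of \<open>A\<close> avoids \<open>B\<close>
  and hence lies in \<open>C\<close>, or \<open>B\<close> is dense in \<open>A\<close>, and then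
  \<open>V\<close> has the same closed trace on \<open>A\<close> as on the part of \<open>A\<close>
  in \<open>B\<close>.\<close>

lemma tame_Un:
  assumes "tame X Y f B" "tame X Y f C"
  shows "tame X Y f (B \<union> C)"
  unfolding tame_def
proof (intro allI impI)
  fix A assume A: "A \<subseteq> B \<union> C" "A \<noteq> {}"
  show "\<exists>V. openin X V \<and> V \<inter> A \<noteq> {} \<and>
       continuous_map (subtopology X (X closure_of (V \<inter> A))) Y f"
  proof (cases "\<exists>V. openin X V \<and> V \<inter> A \<noteq> {} \<and> V \<inter> A \<inter> B = {}")
    case True
    then obtain V where V: "openin X V" "V \<inter> A \<noteq> {}" "V \<inter> A \<inter> B = {}"
      by blast
    then have "V \<inter> A \<subseteq> C"
      using A by blast
    then obtain V' where V': "openin X V'" "V' \<inter> (V \<inter> A) \<noteq> {}"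
      "continuous_map (subtopology X (X closure_of (V' \<inter> (V \<inter> A)))) Y f"
      using assms(2) V unfolding tame_def by meson
    then show ?thesis
      using V by (intro exI[of _ "V' \<inter> V"]) (auto simp: Int_assoc)
  next
    case False
    show ?thesis
    proof (cases "A \<inter> B = {}")
      \<comment> \<open>This occurs only if no open set meets \<open>A\<close>, as \<open>A\<close>
        is not assumed to lie in the space.\<close>
      case True
      then have "A \<subseteq> C"
        using A by blast
      then show ?thesis
        using assms(2) A unfolding tame_def by meson
    next
      case ne: False
      then obtain V where V: "openin X V" "V \<inter> (A \<inter> B) \<noteq> {}"
        "continuous_map (subtopology X (X closure_of (V \<inter> (A \<inter> B)))) Y f"
        using assms(1) unfolding tame_def by (meson inf_le2)
      have "X closure_of (V \<inter> A) \<subseteq> X closure_of (V \<inter> (A \<inter> B))"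
      proof
        fix x assume x: "x \<in> X closure_of (V \<inter> A)"
        have "\<exists>y. y \<in> V \<inter> (A \<inter> B) \<and> y \<in> T" if T: "x \<in> T" "openin X T" for T
        proof -
          have "openin X (T \<inter> V)" "T \<inter> V \<inter> A \<noteq> {}"
            using x T V(1) by (auto simp: in_closure_of)
          then show ?thesis
            using False by blast
        qed
        then show "x \<in> X closure_of (V \<inter> (A \<inter> B))"
          using x by (auto simp: in_closure_of)
      qed
      then have "X closure_of (V \<inter> A) = X closure_of (V \<inter> (A \<inter> B))"
        by (simp add: closure_of_mono subset_antisym le_infI1 le_infI2)
      then show ?thesis
        using V by (intro exI[of _ V]) auto
    qed
  qed
qed

section \<open>Splitting points of sets that are not tame\<close>

text \<open>Resolvability enters only through \<open>decided\<close>, which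
  \<open>resolvable_locally_decided\<close> supplies for preimages of open sets.\<close>

locale locally_decided_map =
  fixes X :: "'a topology" and Y :: "'b topology" and f :: "'a \<Rightarrow> 'b"
  assumes regX: "regular_space X" and regY: "regular_space Y"
    and fXY: "f \<in> topspace X \<rightarrow> topspace Y"
    and decided: "\<And>U A. openin Y U \<Longrightarrow> A \<subseteq> topspace X \<Longrightarrow> A \<noteq> {} \<Longrightarrow>
      \<exists>V. openin X V \<and> V \<inter> A \<noteq> {} \<and> (f ` (V \<inter> A) \<subseteq> U \<or> f ` (V \<inter> A) \<inter> U = {})"
begin

text \<open>A witness against tameness stays one on each nonempty relatively open part. By
  \<open>decided\<close>, some open \<open>V\<close> settles \<open>U\<close> on the closure of the
  witness; \<open>V\<close> meets the witness itself, where values are in \<open>U\<close>, so the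
  answer is inclusion. Regularity of \<open>X\<close> then shrinks \<open>V\<close>.\<close>

lemma not_tame_closure_into:
  assumes "\<not> tame X Y f B" "B \<subseteq> topspace X" "openin Y U" "f ` B \<subseteq> U"
  obtains A where "A \<subseteq> B" "f ` (X closure_of A) \<subseteq> U"
    "\<not> continuous_map (subtopology X (X closure_of A)) Y f"
    "\<And>V. openin X V \<Longrightarrow> V \<inter> A \<noteq> {} \<Longrightarrow> \<not> tame X Y f (V \<inter> A)"
proof -
  obtain A where A: "A \<subseteq> B" "A \<noteq> {}"
    and disc: "\<And>V. openin X V \<Longrightarrow> V \<inter> A \<noteq> {} \<Longrightarrow>
      \<not> continuous_map (subtopology X (X closure_of (V \<inter> A))) Y f"
    using assms(1) unfolding tame_def by metis
  have nt: "\<not> tame X Y f (V \<inter> A)" if V: "openin X V" "V \<inter> A \<noteq> {}" for V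
  proof
    assume "tame X Y f (V \<inter> A)"
    then obtain V' where "openin X V'" "V' \<inter> (V \<inter> A) \<noteq> {}"
      "continuous_map (subtopology X (X closure_of (V' \<inter> (V \<inter> A)))) Y f"
      using V unfolding tame_def by (meson order_refl)
    then show False
      using disc[of "V' \<inter> V"] V by (auto simp: Int_assoc)
  qed
  have AX: "A \<subseteq> X closure_of A"
    using A assms(2) by (intro closure_of_subset) auto
  have "X closure_of A \<noteq> {}"
    using AX A(2) by blast
  from decided[OF assms(3) closure_of_subset_topspace this]
  obtain V where V: "openin X V" "V \<inter> X closure_of A \<noteq> {}"
    "f ` (V \<inter> X closure_of A) \<subseteq> U \<or> f ` (V \<inter> X closure_of A) \<inter> U = {}"
    by metis
  have VA: "V \<inter> A \<noteq> {}"
    using V openin_Int_closure_of_eq_empty by metis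
  then have VU: "f ` (V \<inter> X closure_of A) \<subseteq> U"
    using V(3) AX A(1) assms(4) by blast
  obtain x where x: "x \<in> V" "x \<in> A"
    using VA by blast
  obtain V' where V': "openin X V'" "x \<in> V'" "X closure_of V' \<subseteq> V"
    using regular_space_shrink[OF regX V(1) x(1)] .
  show ?thesis
  proof (rule that[of "V' \<inter> A"])
    have "X closure_of (V' \<inter> A) \<subseteq> V \<inter> X closure_of A"
      using V'(3) closure_of_mono[of "V' \<inter> A" V' X] closure_of_mono[of "V' \<inter> A" A X] by blast
    then show "f ` (X closure_of (V' \<inter> A)) \<subseteq> U"
      using VU by blast
    show "\<not> continuous_map (subtopology X (X closure_of (V' \<inter> A))) Y f"
      using disc V' x by blast
    show "\<not> tame X Y f (T \<inter> (V' \<inter> A))" if "openin X T" "T \<inter> (V' \<inter> A) \<noteq> {}" for T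
      using nt[of "T \<inter> V'"] that V' by (auto simp: Int_assoc)
  qed (use A in blast)
qed

text \<open>Otherwise, near each point \<open>y\<close> of the closure of \<open>A\<close>, all of
  \<open>A\<close> but a tame set is mapped close to \<open>f y\<close>. At a discontinuity this
  holds for two values with disjoint closed neighbourhoods at once, which makes a nonempty
  relatively open part of \<open>A\<close> tame.\<close>

lemma exists_splitting_point:
  assumes "\<not> tame X Y f B" "B \<subseteq> topspace X" "openin Y U" "f ` B \<subseteq> U"
  shows "\<exists>y W. y \<in> X closure_of B \<and> openin Y W \<and> f y \<in> W \<and> Y closure_of W \<subseteq> U \<and>
    (\<forall>V. openin X V \<and> y \<in> V \<longrightarrow> \<not> tame X Y f {z \<in> V \<inter> B. f z \<notin> Y closure_of W})"
proof (rule ccontr)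
  assume contra: "\<not> ?thesis"
  obtain A where A: "A \<subseteq> B" "f ` (X closure_of A) \<subseteq> U"
    "\<not> continuous_map (subtopology X (X closure_of A)) Y f"
    and nt: "\<And>V. openin X V \<Longrightarrow> V \<inter> A \<noteq> {} \<Longrightarrow> \<not> tame X Y f (V \<inter> A)"
    using not_tame_closure_into[OF assms] by metis
  have local: "\<exists>V. openin X V \<and> y \<in> V \<and> tame X Y f {z \<in> V \<inter> A. f z \<notin> Y closure_of W}"
    if y: "y \<in> X closure_of A" "openin Y W" "f y \<in> W" "Y closure_of W \<subseteq> U" for y W
  proof -
    have "y \<in> X closure_of B"
      using y closure_of_mono[OF A(1)] by blast
    then obtain V where "openin X V" "y \<in> V" "tame X Y f {z \<in> V \<inter> B. f z \<notin> Y closure_of W}"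
      using contra y by blast
    moreover from this(3) have "tame X Y f {z \<in> V \<inter> A. f z \<notin> Y closure_of W}"
      by (rule tame_subset) (use A(1) in blast)
    ultimately show ?thesis
      by blast
  qed
  obtain x W where x: "x \<in> X closure_of A" "openin Y W" "f x \<in> W"
    and far: "\<And>V. openin X V \<Longrightarrow> x \<in> V \<Longrightarrow> \<not> f ` (V \<inter> X closure_of A) \<subseteq> W"
    using A(3) unfolding continuous_map_subtopology_iff[OF fXY closure_of_subset_topspace]
    by metis
  have "openin Y (W \<inter> U)" "f x \<in> W \<inter> U"
    using x A(2) assms(3) by auto
  then obtain W1 where W1: "openin Y W1" "f x \<in> W1" "Y closure_of W1 \<subseteq> W \<inter> U"
    by (rule regular_space_shrink[OF regY])
  obtain V1 where V1: "openin X V1" "x \<in> V1" "tame X Y f {z \<in> V1 \<inter> A. f z \<notin> Y closure_of W1}"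
    using local[OF x(1) W1(1,2)] W1(3) by blast
  obtain z where z: "z \<in> V1" "z \<in> X closure_of A" "f z \<notin> W"
    using far[OF V1(1,2)] by blast
  have "openin Y (U - Y closure_of W1)" "f z \<in> U - Y closure_of W1"
    using z W1 A(2) assms(3) by auto
  then obtain W2 where W2: "openin Y W2" "f z \<in> W2" "Y closure_of W2 \<subseteq> U - Y closure_of W1"
    by (rule regular_space_shrink[OF regY])
  obtain V2 where V2: "openin X V2" "z \<in> V2" "tame X Y f {z \<in> V2 \<inter> A. f z \<notin> Y closure_of W2}"
    using local[OF z(2) W2(1,2)] W2(3) by blast
  have "V1 \<inter> V2 \<inter> X closure_of A \<noteq> {}"
    using z(1,2) V2(2) by blast
  then have "V1 \<inter> V2 \<inter> A \<noteq> {}"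
    using openin_Int_closure_of_eq_empty[OF openin_Int[OF V1(1) V2(1)], of A] by metis
  \<comment> \<open>No value lies in both closures, so each point belongs to one of the two tame
    exceptional sets.\<close>
  moreover have "tame X Y f (V1 \<inter> V2 \<inter> A)"
    by (rule tame_subset[OF tame_Un[OF V1(3) V2(3)]]) (use W2(3) in blast)
  ultimately show False
    using nt[of "V1 \<inter> V2"] V1 V2 by blast
qed

section \<open>Adding points while earlier ones stay usable\<close>

text \<open>Here \<open>D\<close> is the union of the closed neighbourhoods already spent; a hot
  point can still be approached by new points whose values avoid \<open>D\<close>.\<close>

definition hot :: "'a \<Rightarrow> 'b set \<Rightarrow> bool" where
  "hot x D \<longleftrightarrow> (\<forall>V. openin X V \<and> x \<in> V \<longrightarrow> \<not> tame X Y f {z \<in> V. f z \<notin> D})"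

text \<open>
  Each \<open>p\<close> can be spoilt by at most one of several candidates \<open>W\<close> with disjoint closures; so if a
  candidate spoils \<open>p\<close>, any later one that avoids it is harmless for \<open>p\<close>.
\<close>

lemma exists_splitting_point_keeping_hot:
  assumes "finite P" "\<forall>p\<in>P. hot p C"
    and "\<not> tame X Y f B" "B \<subseteq> topspace X" "openin Y U" "f ` B \<subseteq> U"
  shows "\<exists>y W. y \<in> X closure_of B \<and> openin Y W \<and> f y \<in> W \<and> Y closure_of W \<subseteq> U \<and>
    (\<forall>V. openin X V \<and> y \<in> V \<longrightarrow> \<not> tame X Y f {z \<in> V \<inter> B. f z \<notin> Y closure_of W}) \<and>
    (\<forall>p\<in>P. hot p (C \<union> Y closure_of W))"
  using assms
proof (induction P arbitrary: B U rule: finite_induct)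
  case empty
  then show ?case
    using exists_splitting_point[of B U] by simp
next
  case (insert p P)
  have hP: "\<forall>q\<in>P. hot q C"
    using insert.prems(1) by simp
  obtain y W where y: "y \<in> X closure_of B" "openin Y W" "f y \<in> W" "Y closure_of W \<subseteq> U"
    "\<forall>V. openin X V \<and> y \<in> V \<longrightarrow> \<not> tame X Y f {z \<in> V \<inter> B. f z \<notin> Y closure_of W}"
    "\<forall>q\<in>P. hot q (C \<union> Y closure_of W)"
    using insert.IH[OF hP insert.prems(2-5)] by (elim exE conjE) (rule that)
  show ?case
  proof (cases "hot p (C \<union> Y closure_of W)")
    case True
    then show ?thesis
      using y by (intro exI[of _ y] exI[of _ W]) auto
  next
    case False
    then obtain V1 where V1: "openin X V1" "p \<in> V1"
      "tame X Y f {z \<in> V1. f z \<notin> C \<union> Y closure_of W}"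
      by (auto simp: hot_def)
    \<comment> \<open>The first candidate spoils \<open>p\<close>, so the search is repeated among
      points mapped off its closure. They form a set that is not tame because \<open>y\<close> is a
      splitting point.\<close>
    define B' where "B' = {z \<in> B. f z \<notin> Y closure_of W}"
    define U' where "U' = U - Y closure_of W"
    have "y \<in> topspace X"
      using y(1) by (simp add: in_closure_of)
    then have "\<not> tame X Y f {z \<in> topspace X \<inter> B. f z \<notin> Y closure_of W}"
      using y(5) by blast
    then have B': "\<not> tame X Y f B'" "B' \<subseteq> B" "B' \<subseteq> topspace X" "openin Y U'" "f ` B' \<subseteq> U'"
      using insert.prems
      by (auto simp: B'_def U'_def Int_absorb1)
    obtain y' W' where y': "y' \<in> X closure_of B'" "openin Y W'" "f y' \<in> W'"
      "Y closure_of W' \<subseteq> U'"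
      "\<forall>V. openin X V \<and> y' \<in> V \<longrightarrow> \<not> tame X Y f {z \<in> V \<inter> B'. f z \<notin> Y closure_of W'}"
      "\<forall>q\<in>P. hot q (C \<union> Y closure_of W')"
      using insert.IH[OF hP B'(1,3,4,5)] by (elim exE conjE) (rule that)
    have "hot p (C \<union> Y closure_of W')"
      unfolding hot_def
    proof (intro allI impI notI)
      fix V2 assume V2: "openin X V2 \<and> p \<in> V2"
        "tame X Y f {z \<in> V2. f z \<notin> C \<union> Y closure_of W'}"
      \<comment> \<open>The closures of \<open>W\<close> and \<open>W'\<close> are disjoint, so if
        both candidates spoiled \<open>p\<close>, it would not have been hot for
        \<open>C\<close>.\<close>
      have "tame X Y f {z \<in> V1 \<inter> V2. f z \<notin> C}"
        by (rule tame_subset[OF tame_Un[OF V1(3) V2(2)]]) (use y'(4) in \<open>auto simp: U'_def\<close>)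
      moreover have "hot p C"
        using insert.prems(1) by blast
      ultimately show False
        using V1 V2 by (auto simp: hot_def)
    qed
    moreover have "\<not> tame X Y f {z \<in> V \<inter> B. f z \<notin> Y closure_of W'}"
      if "openin X V" "y' \<in> V" for V
    proof
      assume "tame X Y f {z \<in> V \<inter> B. f z \<notin> Y closure_of W'}"
      then have "tame X Y f {z \<in> V \<inter> B'. f z \<notin> Y closure_of W'}"
        by (rule tame_subset) (use B'(2) in blast)
      then show False
        using y'(5) that by blast
    qed
    moreover have "y' \<in> X closure_of B"
      using y'(1) closure_of_mono[OF B'(2)] by blast
    ultimately show ?thesis
      using y' by (intro exI[of _ y'] exI[of _ W']) (auto simp: U'_def)
  qed
qed

text \<open>Since \<open>p\<close> is hot, the points near \<open>p\<close> with values off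
  \<open>C\<close> form a set \<open>B\<close> that is not tame, and a splitting point of
  \<open>B\<close> is itself hot. That point is only known to lie in the closure of
  \<open>B\<close>, hence the smaller neighbourhood \<open>V'\<close>.\<close>

lemma exists_next_point:
  assumes "finite P" "\<forall>p\<in>P. hot p C" "closedin Y C" "p \<in> P" "openin X V" "p \<in> V"
  shows "\<exists>y W. y \<in> V \<and> openin Y W \<and> f y \<in> W \<and> Y closure_of W \<inter> C = {} \<and>
    (\<forall>q\<in>insert y P. hot q (C \<union> Y closure_of W))"
proof -
  obtain V' where V': "openin X V'" "p \<in> V'" "X closure_of V' \<subseteq> V"
    using regular_space_shrink[OF regX assms(5,6)] .
  define B where "B = {z \<in> V'. f z \<notin> C}"
  have B: "B \<subseteq> topspace X" "\<not> tame X Y f B"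
    using V' assms(2,4) openin_subset[OF V'(1)] by (auto simp: B_def hot_def)
  have U: "openin Y (topspace Y - C)" "f ` B \<subseteq> topspace Y - C"
    using assms(3) fXY B by (auto simp: B_def)
  obtain y W where y: "y \<in> X closure_of B" "openin Y W" "f y \<in> W"
    "Y closure_of W \<subseteq> topspace Y - C"
    "\<forall>V. openin X V \<and> y \<in> V \<longrightarrow> \<not> tame X Y f {z \<in> V \<inter> B. f z \<notin> Y closure_of W}"
    "\<forall>p\<in>P. hot p (C \<union> Y closure_of W)"
    using exists_splitting_point_keeping_hot[OF assms(1,2) B(2,1) U]
    by (elim exE conjE) (rule that)
  have "y \<in> V"
    using y(1) V'(3) closure_of_mono[of B V' X] by (auto simp: B_def)
  moreover have "hot y (C \<union> Y closure_of W)"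
    unfolding hot_def
  proof (intro allI impI notI)
    fix T assume T: "openin X T \<and> y \<in> T" "tame X Y f {z \<in> T. f z \<notin> C \<union> Y closure_of W}"
    have "tame X Y f {z \<in> T \<inter> B. f z \<notin> Y closure_of W}"
      by (rule tame_subset[OF T(2)]) (auto simp: B_def)
    then show False
      using y(5) T(1) by blast
  qed
  ultimately show ?thesis
    using y by (intro exI[of _ y] exI[of _ W]) auto
qed

section \<open>A sequence without isolated points whose values are separated\<close>

text \<open>A recursion on finite lists of pairs \<open>(x, W)\<close>, with all points kept hot.
  The step with number \<open>prod_encode (i, j)\<close> adds a point within
  \<open>1 / Suc j\<close> of \<open>x i\<close>, so each point is approached by later ones.\<close>

lemma exists_disjoint_values_sequence:
  assumes "Metric_space M d" "X = Metric_space.mtopology M d" "\<not> tame X Y f (topspace X)"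
  obtains x W where
    "\<And>n. x n \<in> M" "\<And>n. openin Y (W n)" "\<And>n. f (x n) \<in> W n"
    "\<And>m n. n < m \<Longrightarrow> W m \<inter> W n = {}"
    "\<And>i j. d (x i) (x (Suc (prod_encode (i, j)))) < 1 / Suc j"
proof -
  interpret Metric_space M d
    by fact
  have X: "X = mtopology" "topspace X = M"
    using assms(2) by simp_all
  define D where "D L = (\<Union>p\<in>set L. Y closure_of snd p)" for L :: "('a \<times> 'b set) list"
  define P where "P n L \<longleftrightarrow> length L = Suc n \<and>
    (\<forall>p\<in>set L. fst p \<in> M \<and> openin Y (snd p) \<and> f (fst p) \<in> snd p \<and> hot (fst p) (D L))" for n L
  define Q where "Q n L L' \<longleftrightarrow> (\<exists>y W. L' = L @ [(y, W)] \<and>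
    y \<in> mball (fst (L ! fst (prod_decode n))) (1 / Suc (snd (prod_decode n))) \<and>
    Y closure_of W \<inter> D L = {})" for n L L'
  \<comment> \<open>The list at stage \<open>n\<close> holds the points with indices
    \<open>0\<close> to \<open>n\<close>, so the point to be approached is already there.\<close>
  have fst_le: "fst (prod_decode n) \<le> n" for n
    using le_prod_encode_1[of "fst (prod_decode n)" "snd (prod_decode n)"] by simp
  have "\<exists>g. \<forall>n. P n (g n) \<and> Q n (g n) (g (Suc n))"
  proof (rule dependent_nat_choice)
    have "f ` topspace X \<subseteq> topspace Y"
      using fXY by auto
    from exists_splitting_point[OF assms(3) order_refl openin_topspace this]
    obtain y W where y: "y \<in> X closure_of topspace X" "openin Y W" "f y \<in> W"
      "\<forall>V. openin X V \<and> y \<in> V \<longrightarrow> \<not> tame X Y f {z \<in> V \<inter> topspace X. f z \<notin> Y closure_of W}"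
      by (elim exE conjE) (rule that)
    have "hot y (Y closure_of W)"
      unfolding hot_def
    proof (intro allI impI)
      fix V assume V: "openin X V \<and> y \<in> V"
      then have "V \<inter> topspace X = V"
        using openin_subset by blast
      then show "\<not> tame X Y f {z \<in> V. f z \<notin> Y closure_of W}"
        using y(4) V by metis
    qed
    then show "\<exists>L. P 0 L"
      using y X(2) by (intro exI[of _ "[(y, W)]"]) (auto simp: P_def D_def)
  next
    fix L n assume P: "P n L"
    define p where "p = fst (L ! fst (prod_decode n))"
    have "L ! fst (prod_decode n) \<in> set L"
      using P fst_le[of n] by (auto simp: P_def)
    then have p: "p \<in> fst ` set L" "p \<in> M"
      using P by (auto simp: p_def P_def)
    have fin: "finite (fst ` set L)" and hot: "\<forall>q\<in>fst ` set L. hot q (D L)"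
      using P by (auto simp: P_def)
    have cl: "closedin Y (D L)"
      unfolding D_def by (intro closedin_Union) auto
    define V where "V = mball p (1 / Suc (snd (prod_decode n)))"
    have V: "openin X V" "p \<in> V"
      using p(2) by (auto simp: V_def X(1))
    from exists_next_point[OF fin hot cl p(1) V]
    obtain y W where y: "y \<in> V" "openin Y W" "f y \<in> W" "Y closure_of W \<inter> D L = {}"
      "\<forall>q\<in>insert y (fst ` set L). hot q (D L \<union> Y closure_of W)"
      by (elim exE conjE) (rule that)
    have "D (L @ [(y, W)]) = D L \<union> Y closure_of W" "y \<in> M"
      using y(1) by (auto simp: D_def V_def)
    then have "P (Suc n) (L @ [(y, W)])"
      using P y by (auto simp: P_def)
    moreover have "Q n L (L @ [(y, W)])"
      using y(1,4) by (auto simp: Q_def V_def p_def)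
    ultimately show "\<exists>L'. P (Suc n) L' \<and> Q n L L'"
      by blast
  qed
  then obtain g where P: "\<And>n. P n (g n)" and Q: "\<And>n. Q n (g n) (g (Suc n))"
    by blast
  define x where "x n = fst (g n ! n)" for n
  define W where "W n = snd (g n ! n)" for n
  have len: "length (g n) = Suc n" for n
    using P[of n] by (simp add: P_def)
  have stable: "g m ! n = g n ! n" if "n \<le> m" for m n
    using that
  proof (induction m rule: dec_induct)
    case (step m)
    obtain p where "g (Suc m) = g m @ [p]"
      using Q[of m] by (auto simp: Q_def)
    then show ?case
      using step len[of m] by (simp add: nth_append)
  qed simp
  have "g n ! n \<in> set (g n)" for n
    using len[of n] by simp
  then have each: "x n \<in> M \<and> openin Y (W n) \<and> f (x n) \<in> W n" for n
    using P[of n] by (auto simp: P_def x_def W_def)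
  have last: "x (Suc n) \<in> mball (x (fst (prod_decode n))) (1 / Suc (snd (prod_decode n))) \<and>
      Y closure_of W (Suc n) \<inter> D (g n) = {}" for n
  proof -
    obtain y U where yU: "g (Suc n) = g n @ [(y, U)]"
      "y \<in> mball (fst (g n ! fst (prod_decode n))) (1 / Suc (snd (prod_decode n)))"
      "Y closure_of U \<inter> D (g n) = {}"
      using Q[of n] by (auto simp: Q_def)
    have "x (Suc n) = y" "W (Suc n) = U"
      using yU(1) len[of n] by (auto simp: x_def W_def nth_append)
    then show ?thesis
      using yU(2,3) stable[OF fst_le[of n]] by (simp add: x_def)
  qed
  have disj: "W m \<inter> W n = {}" if mn: "n < m" for m n
  proof -
    obtain k where k: "m = Suc k" "n \<le> k"
      using mn by (cases m) auto
    have sub: "W i \<subseteq> Y closure_of W i" for i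
      using each openin_subset by (intro closure_of_subset) blast
    have "g k ! n \<in> set (g k)"
      using k(2) len[of k] by simp
    then have "Y closure_of W n \<subseteq> D (g k)"
      using stable[OF k(2)] by (auto simp: D_def W_def)
    then show ?thesis
      using last[of k] sub[of n] sub[of m] k(1) by blast
  qed
  have near: "d (x i) (x (Suc (prod_encode (i, j)))) < 1 / Suc j" for i j
    using last[of "prod_encode (i, j)"] by simp
  show ?thesis
    using that each disj near by blast
qed

text \<open>The points chosen near \<open>x i\<close> are put into the preimage of \<open>U\<close>
  or kept out of it by the parity of \<open>j\<close>, so no open set meeting \<open>range x\<close>
  decides \<open>U\<close> there.\<close>

lemma tame_topspace:
  assumes "Metric_space M d" "X = Metric_space.mtopology M d"
  shows "tame X Y f (topspace X)"
proof (rule ccontr)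
  assume "\<not> tame X Y f (topspace X)"
  then obtain x W where x: "\<And>n. x n \<in> M" and W: "\<And>n. openin Y (W n)" "\<And>n. f (x n) \<in> W n"
    and disj: "\<And>m n. n < m \<Longrightarrow> W m \<inter> W n = {}"
    and near: "\<And>i j. d (x i) (x (Suc (prod_encode (i, j)))) < 1 / Suc j"
    using exists_disjoint_values_sequence[OF assms] by blast
  interpret Metric_space M d
    by fact
  have X: "X = mtopology" "topspace X = M"
    using assms(2) by simp_all
  define S where "S = {Suc (prod_encode (i, 2 * j)) | i j. True}"
  define U where "U = (\<Union>n\<in>S. W n)"
  have inU: "f (x n) \<in> U \<longleftrightarrow> n \<in> S" for n
  proof
    assume "f (x n) \<in> U"
    then obtain m where "m \<in> S" "f (x n) \<in> W m"
      by (auto simp: U_def)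
    then show "n \<in> S"
      using disj[of m n] disj[of n m] W(2)[of n] by (cases m n rule: linorder_cases) auto
  qed (use W in \<open>auto simp: U_def\<close>)
  have "openin Y U"
    unfolding U_def using W by blast
  moreover have "range x \<subseteq> topspace X" "range x \<noteq> {}"
    using x X by auto
  ultimately obtain V where V: "openin X V" "V \<inter> range x \<noteq> {}"
    "f ` (V \<inter> range x) \<subseteq> U \<or> f ` (V \<inter> range x) \<inter> U = {}"
    using decided by metis
  obtain i where "x i \<in> V"
    using V(2) by blast
  then obtain r where r: "r > 0" "mball (x i) r \<subseteq> V"
    using V(1) unfolding X(1) openin_mtopology by blast
  obtain k where k: "1 / Suc k < r"
    using nat_approx_posE[OF r(1)] by metis
  \<comment> \<open>All late approximants of \<open>x i\<close> are in \<open>V\<close>, so both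
    parities occur there.\<close>
  have inV: "x (Suc (prod_encode (i, j))) \<in> V" if "k \<le> j" for j
  proof -
    have "1 / Suc j \<le> 1 / Suc k"
      using that by (intro divide_left_mono) auto
    then have "d (x i) (x (Suc (prod_encode (i, j)))) < r"
      using near[of i j] k by linarith
    then show ?thesis
      using r(2) x by auto
  qed
  have "Suc (prod_encode (i, 2 * k)) \<in> S"
    by (auto simp: S_def)
  moreover have "Suc (prod_encode (i, Suc (2 * k))) \<notin> S"
    unfolding S_def by (auto, presburger)
  ultimately have "f (x (Suc (prod_encode (i, 2 * k)))) \<in> U"
    "f (x (Suc (prod_encode (i, Suc (2 * k))))) \<notin> U"
    by (simp_all add: inU)
  then show False
    using V(3) inV[of "2 * k"] inV[of "Suc (2 * k)"] by auto
qed

end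

section \<open>From local to piecewise continuity\<close>

text \<open>The transfinite iterates of \<open>s\<close> from the empty set, without ordinals: the
  union of the empty family provides the start.\<close>

inductive_set tower :: "('a set \<Rightarrow> 'a set) \<Rightarrow> 'a set set" for s :: "'a set \<Rightarrow> 'a set" where
  step: "G \<in> tower s \<Longrightarrow> s G \<in> tower s"
| Union: "(\<And>K. K \<in> \<K> \<Longrightarrow> K \<in> tower s) \<Longrightarrow> \<Union>\<K> \<in> tower s"

text \<open>The double induction of the Bourbaki-Witt theorem: an inner induction on
  \<open>H\<close> compares everything with an \<open>extreme\<close> set, and an outer one shows
  that every member is \<open>extreme\<close>.\<close>

lemma tower_dichotomy:
  assumes inc: "\<And>G. G \<subseteq> s G" and G: "G \<in> tower s" and H: "H \<in> tower s"
  shows "H \<subseteq> G \<or> s G \<subseteq> H"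
proof -
  define extreme where "extreme C \<longleftrightarrow> (\<forall>H\<in>tower s. H \<subset> C \<longrightarrow> s H \<subseteq> C)" for C
  have dich: "H \<subseteq> C \<or> s C \<subseteq> H" if "extreme C" "H \<in> tower s" for C H
    using that(2)
  proof induction
    case (step H)
    then show ?case
      using that(1) inc[of H] unfolding extreme_def by blast
  next
    case (Union \<K>)
    then show ?case
      by blast
  qed
  have "extreme G"
    using G
  proof induction
    case (step G)
    show ?case
      unfolding extreme_def
    proof (intro ballI impI)
      fix H assume H: "H \<in> tower s" "H \<subset> s G"
      then have "H \<subseteq> G"
        using dich[OF step.IH] by blast
      then show "s H \<subseteq> s G"
        using step.IH H inc[of G] unfolding extreme_def by blast
    qed
  next
    case (Union \<K>)
    show ?case
      unfolding extreme_def
    proof (intro ballI impI)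
      fix H assume H: "H \<in> tower s" "H \<subset> \<Union>\<K>"
      then obtain K where K: "K \<in> \<K>" "\<not> K \<subseteq> H"
        by blast
      then have ext: "extreme K"
        using Union.IH by blast
      then have "H \<subset> K"
        using dich[OF ext H(1)] inc[of K] K(2) by blast
      then have "s H \<subseteq> K"
        using ext H(1) unfolding extreme_def by blast
      then show "s H \<subseteq> \<Union>\<K>"
        using K(1) by blast
    qed
  qed
  then show ?thesis
    using dich H by blast
qed

section \<open>Closed pieces cut from the layers of an open filtration\<close>

lemma (in Metric_space) piecewise_continuous_if_locally_continuous:
  assumes fY: "f \<in> M \<rightarrow> topspace Y"
    and local: "\<And>A. closedin mtopology A \<Longrightarrow> A \<noteq> {} \<Longrightarrow>
      \<exists>V. openin mtopology V \<and> V \<inter> A \<noteq> {} \<and>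
        continuous_map (subtopology mtopology (V \<inter> A)) Y f"
  shows "piecewise_continuous mtopology Y f"
proof -
  note cont_iff = continuous_map_subtopology_iff[of f mtopology Y, unfolded topspace_mtopology, OF fY]
  define s where
    "s G = \<Union>{V. openin mtopology V \<and> continuous_map (subtopology mtopology (V - G)) Y f} \<union> G" for G
  have inc: "G \<subseteq> s G" for G
    by (auto simp: s_def)
  have op: "openin mtopology G" if "G \<in> tower s" for G
    using that
  proof induction
    case (step G)
    then show ?case
      unfolding s_def by (intro openin_Un openin_Union) auto
  next
    case (Union \<K>)
    then show ?case
      by (intro openin_Union) auto
  qed
  \<comment> \<open>The largest stage missing \<open>x\<close>; the layer containing
    \<open>x\<close> is \<open>s (G x) - G x\<close>, and \<open>G\<close> is constant on
    it.\<close>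
  define G where "G x = \<Union>{H \<in> tower s. x \<notin> H}" for x
  have G_tower: "G x \<in> tower s" for x
    unfolding G_def by (rule tower.Union) auto
  have notin: "x \<notin> G x" for x
    by (auto simp: G_def)
  have G_max: "H \<subseteq> G x" if "H \<in> tower s" "x \<notin> H" for H x
    using that by (auto simp: G_def)
  have sG_op: "openin mtopology (s (G x))" for x
    by (intro op tower.step G_tower)
  have in_s: "x \<in> s (G x)" if x: "x \<in> M" for x
  \<comment> \<open>If \<open>s (G x)\<close> missed \<open>x\<close>, maximality would make
    \<open>G x\<close> a fixed point of \<open>s\<close>, but \<open>local\<close> on the complement
    of \<open>G x\<close> lets \<open>s\<close> add something.\<close>
  proof (rule ccontr)
    assume "x \<notin> s (G x)"
    then have sub: "s (G x) \<subseteq> G x"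
      by (intro G_max tower.step G_tower)
    have "closedin mtopology (M - G x)" "M - G x \<noteq> {}"
      using op[OF G_tower[of x]] x notin by auto
    then obtain V where V: "openin mtopology V" "V \<inter> (M - G x) \<noteq> {}"
      "continuous_map (subtopology mtopology (V \<inter> (M - G x))) Y f"
      using local by metis
    have "V \<inter> (M - G x) = V - G x"
      using openin_subset[OF V(1)] by auto
    then have "V \<subseteq> s (G x)"
      using V(1,3) by (auto simp: s_def)
    then show False
      using sub V(2) by blast
  qed
  have G_eq: "G y = G x" if "y \<in> s (G x)" "y \<notin> G x" for x y
  proof (rule ccontr)
    assume "G y \<noteq> G x"
    then have "\<not> G y \<subseteq> G x"
      using G_max[OF G_tower that(2)] by blast
    then have "s (G x) \<subseteq> G y"
      using tower_dichotomy[OF inc G_tower G_tower] by blast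
    then show False
      using that(1) notin by blast
  qed
  define e where "e n = 1 / real (Suc n)" for n
  have e_pos: "e n > 0" for n
    by (simp add: e_def)
  define C where "C n = {x \<in> M. mball x (e n) \<subseteq> s (G x)}" for n
  \<comment> \<open>Uniform discreteness: each point lies in the stage \<open>s (G _)\<close> of the
    other, so by the dichotomy neither layer comes strictly earlier.\<close>
  have same: "G y = G x" if "x \<in> C n" "y \<in> C n" "d x y < e n" for x y n
  proof -
    have xy: "x \<in> M" "y \<in> M" "y \<in> s (G x)" "x \<in> s (G y)"
      using that commute by (auto simp: C_def)
    show ?thesis
    proof (cases "y \<in> G x")
      case True
      then have "G x \<noteq> G y" "\<not> G x \<subseteq> G y"
        using notin by auto
      then have "s (G y) \<subseteq> G x"
        using tower_dichotomy[OF inc G_tower G_tower] by blast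
      then show ?thesis
        using xy(4) notin by blast
    next
      case False
      then show ?thesis
        using G_eq xy by blast
    qed
  qed
  have closed: "closedin mtopology (C n)" for n
  proof -
    have "y \<in> C n" if y: "y \<in> mtopology closure_of C n" for y
    proof -
      have yM: "y \<in> M" and near: "\<And>r. r > 0 \<Longrightarrow> \<exists>x\<in>C n. x \<in> mball y r"
        using y by (auto simp: metric_closure_of)
      obtain x where x: "x \<in> C n" "d y x < e n / 2"
        using near[of "e n / 2"] e_pos[of n] by auto
      have xM: "x \<in> M"
        using x(1) by (simp add: C_def)
      \<comment> \<open>Points of \<open>C n\<close> within \<open>e n / 2\<close> of
        \<open>y\<close> are less than \<open>e n\<close> apart, so \<open>y\<close> is a limit of
        points from the single layer of \<open>x\<close>.\<close>
      have near': "\<exists>z\<in>C n. z \<in> mball y r \<and> G z = G x" if r: "r > 0" for r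
      proof -
        obtain z where z: "z \<in> C n" "z \<in> mball y (min r (e n / 2))"
          using near[of "min r (e n / 2)"] r e_pos[of n] by auto
        have "d x z \<le> d y x + d y z"
          using triangle[of x y z] xM yM z by (simp add: commute C_def)
        then have "d x z < e n"
          using z x(2) by auto
        then show ?thesis
          using same[OF x(1) z(1)] z by (intro bexI[of _ z]) auto
      qed
      have ynot: "y \<notin> G x"
      proof
        assume "y \<in> G x"
        then obtain r where "r > 0" "mball y r \<subseteq> G x"
          using op[OF G_tower[of x]] unfolding openin_mtopology by blast
        then show False
          using near' notin by (metis subsetD)
      qed
      have ball: "mball y (e n) \<subseteq> s (G x)"
      proof
        fix w assume w: "w \<in> mball y (e n)"
        define r where "r = e n - d y w"
        have "r > 0"
          using w by (simp add: r_def)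
        then obtain z where z: "z \<in> C n" "z \<in> mball y r" "G z = G x"
          using near' by blast
        have "d z w \<le> d y z + d y w"
          using triangle[of z y w] w z by (simp add: commute)
        then have "w \<in> mball z (e n)"
          using w z by (simp add: r_def)
        then show "w \<in> s (G x)"
          using z by (auto simp: C_def)
      qed
      then have "y \<in> s (G x)"
        using yM e_pos by auto
      then have "G y = G x"
        using G_eq ynot by blast
      then show ?thesis
        using yM ball by (simp add: C_def)
    qed
    moreover have "C n \<subseteq> M"
      by (auto simp: C_def)
    ultimately show ?thesis
      by (metis closure_of_subset_eq subsetI topspace_mtopology)
  qed
  have cont: "continuous_map (subtopology mtopology (C n)) Y f" for n
  proof (subst cont_iff)
    show "C n \<subseteq> M"
      by (auto simp: C_def)
    show "\<forall>x\<in>C n. \<forall>W. openin Y W \<and> f x \<in> W \<longrightarrow>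
      (\<exists>V. openin mtopology V \<and> x \<in> V \<and> f ` (V \<inter> C n) \<subseteq> W)"
    proof (intro ballI allI impI)
      fix x W assume x: "x \<in> C n" and W: "openin Y W \<and> f x \<in> W"
      have xM: "x \<in> M"
        using x by (simp add: C_def)
      obtain V where V: "openin mtopology V" "x \<in> V"
        "continuous_map (subtopology mtopology (V - G x)) Y f"
        using in_s[OF xM] notin[of x] by (auto simp: s_def)
      have VM: "V - G x \<subseteq> M" and xV: "x \<in> V - G x"
        using openin_subset[OF V(1)] V(2) notin[of x] by auto
      have "\<forall>z\<in>V - G x. \<forall>W. openin Y W \<and> f z \<in> W \<longrightarrow>
        (\<exists>V'. openin mtopology V' \<and> z \<in> V' \<and> f ` (V' \<inter> (V - G x)) \<subseteq> W)"
        using V(3) cont_iff[OF VM] by (rule iffD1[rotated])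
      from this[rule_format, OF xV W]
      obtain V' where V': "openin mtopology V'" "x \<in> V'" "f ` (V' \<inter> (V - G x)) \<subseteq> W"
        by metis
      \<comment> \<open>The ball confines \<open>C n\<close> to the layer of \<open>x\<close>, hence
        to points off \<open>G x\<close>, where \<open>V\<close> gives continuity.\<close>
      define T where "T = V' \<inter> V \<inter> mball x (e n)"
      have "openin mtopology T" "x \<in> T"
        using V V' xM e_pos[of n] by (auto simp: T_def)
      moreover have "f ` (T \<inter> C n) \<subseteq> W"
      proof
        fix u assume "u \<in> f ` (T \<inter> C n)"
        then obtain y where y: "u = f y" "y \<in> T" "y \<in> C n"
          by blast
        then have "G y = G x"
          using same[OF x y(3)] by (simp add: T_def)
        then have "y \<notin> G x"
          using notin[of y] by simp
        then show "u \<in> W"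
          using y V'(3) by (auto simp: T_def)
      qed
      ultimately show "\<exists>V. openin mtopology V \<and> x \<in> V \<and> f ` (V \<inter> C n) \<subseteq> W"
        by blast
    qed
  qed
  have "\<exists>n. x \<in> C n" if x: "x \<in> M" for x
  proof -
    obtain r where r: "r > 0" "mball x r \<subseteq> s (G x)"
      using sG_op[of x] in_s[OF x] unfolding openin_mtopology by blast
    obtain n where "e n < r"
      using nat_approx_posE[OF r(1)] by (auto simp: e_def)
    then have "x \<in> C n"
      using r x mball_subset_concentric[of "e n" r x] by (auto simp: C_def)
    then show ?thesis ..
  qed
  then have "(\<Union>n. C n) = M"
    by (auto simp: C_def)
  then show ?thesis
    using closed cont by (auto simp: piecewise_continuous_def)
qed

theorem theorem4:
  fixes X :: "'a topology" and Y :: "'b topology" and f :: "'a \<Rightarrow> 'b"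
  assumes "metrizable_space X"
    and "regular_space Y" and "t1_space Y"
    and "f \<in> topspace X \<rightarrow> topspace Y"
    and "resolvable_measurable TYPE('i) X Y f"
  shows "piecewise_continuous X Y f"
proof -
  obtain M d where M: "Metric_space M d" "X = Metric_space.mtopology M d"
    using assms(1) by (auto simp: metrizable_space_def)
  interpret Metric_space M d
    by (rule M)
  interpret locally_decided_map X Y f
  proof
    show "regular_space X"
      using assms(1) by (rule metrizable_imp_regular_space)
    show "\<exists>V. openin X V \<and> V \<inter> A \<noteq> {} \<and> (f ` (V \<inter> A) \<subseteq> U \<or> f ` (V \<inter> A) \<inter> U = {})"
      if U: "openin Y U" and A: "A \<subseteq> topspace X" "A \<noteq> {}" for U A
    proof -
      have "resolvable TYPE('i) X {x \<in> topspace X. f x \<in> U}"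
        using assms(5) U by (simp add: resolvable_measurable_def)
      from resolvable_locally_decided[OF this A]
      obtain V where V: "openin X V" "V \<inter> A \<noteq> {}"
        "V \<inter> A \<subseteq> {x \<in> topspace X. f x \<in> U} \<or> V \<inter> A \<inter> {x \<in> topspace X. f x \<in> U} = {}"
        by (elim exE conjE) (rule that)
      have "f ` (V \<inter> A) \<subseteq> U \<or> f ` (V \<inter> A) \<inter> U = {}"
        using V(3) A(1) by auto
      with V(1,2) show ?thesis
        by metis
    qed
  qed (use assms in auto)
  have "\<exists>V. openin mtopology V \<and> V \<inter> A \<noteq> {} \<and>
      continuous_map (subtopology mtopology (V \<inter> A)) Y f"
    if A: "closedin mtopology A" "A \<noteq> {}" for A
  proof -
    have AX: "A \<subseteq> topspace X"
      using closedin_subset[OF A(1)] by (simp only: M(2))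
    from tame_topspace[OF M, unfolded tame_def, rule_format, OF this A(2)]
    obtain V where V: "openin X V" "V \<inter> A \<noteq> {}"
      "continuous_map (subtopology X (X closure_of (V \<inter> A))) Y f"
      by (elim exE conjE) (rule that)
    \<comment> \<open>Continuity on the closure, given by tameness, is restricted to the trace
      itself.\<close>
    have "V \<inter> A \<subseteq> X closure_of (V \<inter> A)"
      using AX by (intro closure_of_subset) auto
    then have "continuous_map (subtopology X (V \<inter> A)) Y f"
      by (rule continuous_map_from_subtopology_mono[OF V(3)])
    then show ?thesis
      using V(1,2) by (auto simp: M(2))
  qed
  moreover have "f \<in> M \<rightarrow> topspace Y"
    using assms(4) by (simp add: M(2))
  ultimately show ?thesis
    unfolding M(2) by (intro piecewise_continuous_if_locally_continuous)
qed

end
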